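(* For a hypergraph $H$ and $n\in\mathbb{Z}_{\ge 0}$ define $$\mathcal{K}(H)_n:=\Bigl(\coprod_{x\in E(H)\coprod V(H)}\Delta[\tilde f_H(x)]_n\Bigr)\Big/\sim,$$ where $\sim$ is the equivalence relation generated by $$\Delta[\tilde f_H(x)]_n\ni (v_{i_0},\dots,v_{i_n})_{\tilde f_H(x)}\sim (v_{i_0},\dots,v_{i_n})_{\tilde f_H(x')}\in\Delta[\tilde f_H(x')]_n$$ for all $x,x'\in E(H)\coprod V(H)$ and all $v_{i_0},\dots,v_{i_n}\in\tilde f_H(x)\cap\tilde f_H(x')$. Write $[v_{i_0},\dots,v_{i_n}]_x$ for the class of $(v_{i_0},\dots,v_{i_n})_{\tilde f_H(x)}$. Then, with structure maps $$\mathcal{K}(H)(\mu)([v_{i_0},\dots,v_{i_n}]_x)=[v_{i_{\mu(0)}},\dots,v_{i_{\mu(m)}}]_x\qquad(\mu:[m]\to[n]),$$ $\mathcal{K}(H)=\{\mathcal{K}(H)_n\}_{n\ge 0}$ is a finite symmetric simplicial set. Moreover, $\mathcal{K}:\mathscr{H}\to[!\Delta^{\mathrm{op}},\mathbf{FinSet}]$ is a functor, where a morphism $\eta=(b,a):H\to H'$ of hypergraphs is sent to $\mathcal{K}(\eta)$ with $$\mathcal{K}(\eta)_n([v_{i_0},\dots,v_{i_n}]_x)=\begin{cases}[a(v_{i_0}),\dots,a(v_{i_n})]_{b(e)} & x=e\in E(H),\\ [a(v_{i_0}),\dots,a(v_{i_n})]_{a(v)} & x=v\in V(H).\end{cases}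$$
   Context: Let $[n]=\{0,\dots,n\}$. The category $!\Delta$ has objects $[n]$, $n\ge 0$, and all functions as morphisms; a finite symmetric simplicial set is a functor ${!\Delta}^{\mathrm{op}}\to\mathbf{FinSet}$. For a set $V$, $\Delta[V]$ is the symmetric simplicial set with $\Delta[V]_n=\mathbf{Set}([n],V)$, i.e. $(n+1)$-tuples $(v_0,\dots,v_n)_V$ of elements of $V$, with $\mu:[m]\to[n]$ acting by precomposition. $\mathcal{P}$ is the endofunctor on finite sets sending $A$ to the set of nonempty subsets of $A$ (functions act by direct image). A hypergraph is a triple $H=(E(H),V(H),f_H)$ with $E(H),V(H)$ finite sets and $f_H:E(H)\to\mathcal{P}(V(H))$ such that no $f_H(e)$ is a one-element set $\{v\}$, $v\in V(H)$. A morphism $H\to H'$ is a pair $(b,a)$ of functions $b:E(H)\to E(H')$, $a:V(H)\to V(H')$ with $f_{H'}\circ b=\mathcal{P}(a)\circ f_H$ (morphisms in the comma category $(\mathrm{Id}\downarrow\mathcal{P})$). $\mathscr{H}$ is the category of hypergraphs. The extended structure map $\tilde f_H:E(H)\coprod V(H)\to\mathcal{P}(V(H))$ is $\tilde f_H(e)=f_H(e)$ for $e\in E(H)$ and $\tilde f_H(v)=\{v\}$ for $v\in V(H)$. *)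

theory Defs
  imports Main "HOL-Library.FuncSet"
begin

text \<open>
  Categories are given by hom-sets, which need not be disjoint; therefore composition, and the
  action of a functor on arrows, take the objects involved as arguments:
  \<open>Comp C a b c g f\<close> is the composite of \<open>f : a \<rightarrow> b\<close> and \<open>g : b \<rightarrow> c\<close>.
\<close>

record ('o, 'm) cat =
  Obj :: "'o set"
  Hom :: "'o \<Rightarrow> 'o \<Rightarrow> 'm set"
  Ident :: "'o \<Rightarrow> 'm"
  Comp :: "'o \<Rightarrow> 'o \<Rightarrow> 'o \<Rightarrow> 'm \<Rightarrow> 'm \<Rightarrow> 'm"

locale category =
  fixes C :: "('o, 'm) cat"
  assumes Ident_in: "a \<in> Obj C \<Longrightarrow> Ident C a \<in> Hom C a a"
    and Comp_in: "\<lbrakk>a \<in> Obj C; b \<in> Obj C; c \<in> Obj C; f \<in> Hom C a b; g \<in> Hom C b c\<rbrakk>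
      \<Longrightarrow> Comp C a b c g f \<in> Hom C a c"
    and Comp_Ident_left: "\<lbrakk>a \<in> Obj C; b \<in> Obj C; f \<in> Hom C a b\<rbrakk>
      \<Longrightarrow> Comp C a b b (Ident C b) f = f"
    and Comp_Ident_right: "\<lbrakk>a \<in> Obj C; b \<in> Obj C; f \<in> Hom C a b\<rbrakk>
      \<Longrightarrow> Comp C a a b f (Ident C a) = f"
    and Comp_assoc: "\<lbrakk>a \<in> Obj C; b \<in> Obj C; c \<in> Obj C; d \<in> Obj C;
      f \<in> Hom C a b; g \<in> Hom C b c; h \<in> Hom C c d\<rbrakk>
      \<Longrightarrow> Comp C a c d h (Comp C a b c g f) = Comp C a b d (Comp C b c d h g) f"

definition op_cat :: "('o, 'm) cat \<Rightarrow> ('o, 'm) cat" where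
  "op_cat C = \<lparr>Obj = Obj C, Hom = (\<lambda>a b. Hom C b a), Ident = Ident C,
     Comp = (\<lambda>a b c g f. Comp C c b a f g)\<rparr>"

record ('o1, 'm1, 'o2, 'm2) functor_data =
  FObj :: "'o1 \<Rightarrow> 'o2"
  FMor :: "'o1 \<Rightarrow> 'o1 \<Rightarrow> 'm1 \<Rightarrow> 'm2"

text \<open>
  The two \<open>undefined\<close> conditions make equality of functors agree with equality on the objects
  and arrows of the source category. They put no restriction on the functor itself.
\<close>

locale cat_functor = C: category C + D: category D
  for C :: "('o1, 'm1) cat" and D :: "('o2, 'm2) cat" +
  fixes F :: "('o1, 'm1, 'o2, 'm2) functor_data"
  assumes FObj_in: "a \<in> Obj C \<Longrightarrow> FObj F a \<in> Obj D"
    and FMor_in: "\<lbrakk>a \<in> Obj C; b \<in> Obj C; f \<in> Hom C a b\<rbrakk>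
      \<Longrightarrow> FMor F a b f \<in> Hom D (FObj F a) (FObj F b)"
    and FMor_Ident: "a \<in> Obj C \<Longrightarrow> FMor F a a (Ident C a) = Ident D (FObj F a)"
    and FMor_Comp: "\<lbrakk>a \<in> Obj C; b \<in> Obj C; c \<in> Obj C; f \<in> Hom C a b; g \<in> Hom C b c\<rbrakk>
      \<Longrightarrow> FMor F a c (Comp C a b c g f)
        = Comp D (FObj F a) (FObj F b) (FObj F c) (FMor F b c g) (FMor F a b f)"
    and FObj_undefined: "a \<notin> Obj C \<Longrightarrow> FObj F a = undefined"
    and FMor_undefined: "\<not> (a \<in> Obj C \<and> b \<in> Obj C \<and> f \<in> Hom C a b)
      \<Longrightarrow> FMor F a b f = undefined"

definition nat_trans ::
  "('o1, 'm1) cat \<Rightarrow> ('o2, 'm2) cat \<Rightarrow> ('o1, 'm1, 'o2, 'm2) functor_data \<Rightarrow>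
   ('o1, 'm1, 'o2, 'm2) functor_data \<Rightarrow> ('o1 \<Rightarrow> 'm2) set" where
  "nat_trans C D F G = {\<alpha> \<in> (\<Pi>\<^sub>E c\<in>Obj C. Hom D (FObj F c) (FObj G c)).
     \<forall>a\<in>Obj C. \<forall>b\<in>Obj C. \<forall>f\<in>Hom C a b.
       Comp D (FObj F a) (FObj F b) (FObj G b) (\<alpha> b) (FMor F a b f)
       = Comp D (FObj F a) (FObj G a) (FObj G b) (FMor G a b f) (\<alpha> a)}"

definition functor_cat ::
  "('o1, 'm1) cat \<Rightarrow> ('o2, 'm2) cat \<Rightarrow>
   (('o1, 'm1, 'o2, 'm2) functor_data, 'o1 \<Rightarrow> 'm2) cat" where
  "functor_cat C D = \<lparr>Obj = {F. cat_functor C D F}, Hom = nat_trans C D,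
     Ident = (\<lambda>F. \<lambda>c\<in>Obj C. Ident D (FObj F c)),
     Comp = (\<lambda>F G H \<beta> \<alpha>. \<lambda>c\<in>Obj C. Comp D (FObj F c) (FObj G c) (FObj H c) (\<beta> c) (\<alpha> c))\<rparr>"

definition FinSet :: "('a set, 'a \<Rightarrow> 'a) cat" where
  "FinSet = \<lparr>Obj = {A. finite A}, Hom = (\<lambda>A B. A \<rightarrow>\<^sub>E B), Ident = (\<lambda>A. \<lambda>x\<in>A. x),
     Comp = (\<lambda>A B C g f. compose A g f)\<rparr>"

text \<open>The category \<open>!\<Delta>\<close>; the number \<open>n\<close> stands for the object \<open>[n] = {0, \<dots>, n}\<close>.\<close>

definition sym_Delta :: "(nat, nat \<Rightarrow> nat) cat" where
  "sym_Delta = \<lparr>Obj = UNIV, Hom = (\<lambda>m n. {..m} \<rightarrow>\<^sub>E {..n}), Ident = (\<lambda>n. \<lambda>i\<in>{..n}. i),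
     Comp = (\<lambda>l m n g f. compose {..l} g f)\<rparr>"

type_synonym 'a sym_sset = "(nat, nat \<Rightarrow> nat, 'a set, 'a \<Rightarrow> 'a) functor_data"

definition fin_sym_sset :: "'a sym_sset \<Rightarrow> bool" where
  "fin_sym_sset X \<longleftrightarrow> cat_functor (op_cat sym_Delta) FinSet X"

text \<open>
  An arrow \<open>n \<rightarrow> m\<close> of the opposite category is a map \<open>\<mu> : [m] \<rightarrow> [n]\<close>, so that \<open>X(\<mu>)\<close> is
  \<open>FMor X n m \<mu>\<close>. The tuple \<open>(v\<^sub>0, \<dots>, v\<^sub>n)\<close> is the function \<open>i \<mapsto> v\<^sub>i\<close> on \<open>{..n}\<close>.
\<close>

definition std_simplex :: "'v set \<Rightarrow> (nat, nat \<Rightarrow> nat, (nat \<Rightarrow> 'v) set, (nat \<Rightarrow> 'v) \<Rightarrow> (nat \<Rightarrow> 'v))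
    functor_data" where
  "std_simplex V = \<lparr>FObj = (\<lambda>n. {..n} \<rightarrow>\<^sub>E V),
     FMor = (\<lambda>n m. \<lambda>\<mu>\<in>{..m} \<rightarrow>\<^sub>E {..n}. \<lambda>t\<in>{..n} \<rightarrow>\<^sub>E V. compose {..m} t \<mu>)\<rparr>"

definition nonempty_Pow :: "'a set \<Rightarrow> 'a set set" where
  "nonempty_Pow A = {S. S \<subseteq> A \<and> S \<noteq> {}}"

record ('e, 'v) hypergraph =
  edges :: "'e set"
  verts :: "'v set"
  ends :: "'e \<Rightarrow> 'v set"

definition hypergraph :: "('e, 'v) hypergraph \<Rightarrow> bool" where
  "hypergraph H \<longleftrightarrow> finite (edges H) \<and> finite (verts H) \<and>
     ends H \<in> edges H \<rightarrow>\<^sub>E nonempty_Pow (verts H) \<and>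
     (\<forall>e\<in>edges H. \<forall>v\<in>verts H. ends H e \<noteq> {v})"

definition hyp_mor :: "('e, 'v) hypergraph \<Rightarrow> ('e, 'v) hypergraph \<Rightarrow>
    (('e \<Rightarrow> 'e) \<times> ('v \<Rightarrow> 'v)) set" where
  "hyp_mor H H' = {(b, a). b \<in> edges H \<rightarrow>\<^sub>E edges H' \<and> a \<in> verts H \<rightarrow>\<^sub>E verts H' \<and>
     (\<forall>e\<in>edges H. ends H' (b e) = a ` ends H e)}"

definition Hyp :: "(('e, 'v) hypergraph, ('e \<Rightarrow> 'e) \<times> ('v \<Rightarrow> 'v)) cat" where
  "Hyp = \<lparr>Obj = {H. hypergraph H}, Hom = hyp_mor,
     Ident = (\<lambda>H. (\<lambda>e\<in>edges H. e, \<lambda>v\<in>verts H. v)),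
     Comp = (\<lambda>H H' H'' (b', a') (b, a). (compose (edges H) b' b, compose (verts H) a' a))\<rparr>"

definition cells :: "('e, 'v) hypergraph \<Rightarrow> ('e + 'v) set" where
  "cells H = edges H <+> verts H"

definition ext_ends :: "('e, 'v) hypergraph \<Rightarrow> 'e + 'v \<Rightarrow> 'v set" where
  "ext_ends H x = (case x of Inl e \<Rightarrow> ends H e | Inr v \<Rightarrow> {v})"

type_synonym ('e, 'v) cell_tuple = "('e + 'v) \<times> (nat \<Rightarrow> 'v)"

definition K_coprod :: "('e, 'v) hypergraph \<Rightarrow> nat \<Rightarrow> ('e, 'v) cell_tuple set" where
  "K_coprod H n = (SIGMA x:cells H. FObj (std_simplex (ext_ends H x)) n)"

definition K_gen :: "('e, 'v) hypergraph \<Rightarrow> nat \<Rightarrow> ('e, 'v) cell_tuple rel" where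
  "K_gen H n = {((x, t), (x', t)) |x x' t. x \<in> cells H \<and> x' \<in> cells H \<and>
     t \<in> {..n} \<rightarrow>\<^sub>E ext_ends H x \<inter> ext_ends H x'}"

definition K_rel :: "('e, 'v) hypergraph \<Rightarrow> nat \<Rightarrow> ('e, 'v) cell_tuple rel" where
  "K_rel H n = \<Inter> {r. equiv (K_coprod H n) r \<and> K_gen H n \<subseteq> r}"

definition K_set :: "('e, 'v) hypergraph \<Rightarrow> nat \<Rightarrow> ('e, 'v) cell_tuple set set" where
  "K_set H n = K_coprod H n // K_rel H n"

definition K_class :: "('e, 'v) hypergraph \<Rightarrow> nat \<Rightarrow> 'e + 'v \<Rightarrow> (nat \<Rightarrow> 'v) \<Rightarrow>
    ('e, 'v) cell_tuple set" where
  "K_class H n x t = K_rel H n `` {(x, t)}"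

text \<open>
  A map given by a formula \<open>g\<close> on representatives sends a class \<open>c\<close> to \<open>the_elem (g ` c)\<close>,
  which is the intended value only if \<open>g\<close> is constant on \<open>c\<close>.
\<close>

definition K_obj :: "('e, 'v) hypergraph \<Rightarrow> ('e, 'v) cell_tuple set sym_sset" where
  "K_obj H = \<lparr>FObj = K_set H,
     FMor = (\<lambda>n m. \<lambda>\<mu>\<in>{..m} \<rightarrow>\<^sub>E {..n}. \<lambda>c\<in>K_set H n.
       the_elem ((\<lambda>(x, t). K_class H m x (\<lambda>i\<in>{..m}. t (\<mu> i))) ` c))\<rparr>"

definition K_mor :: "('e, 'v) hypergraph \<Rightarrow> ('e, 'v) hypergraph \<Rightarrow>
    ('e \<Rightarrow> 'e) \<times> ('v \<Rightarrow> 'v) \<Rightarrow> nat \<Rightarrow> ('e, 'v) cell_tuple set \<Rightarrow> ('e, 'v) cell_tuple set" where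
  "K_mor H H' = (\<lambda>(b, a) n. \<lambda>c\<in>K_set H n.
     the_elem ((\<lambda>(x, t). K_class H' n (map_sum b a x) (\<lambda>i\<in>{..n}. a (t i))) ` c))"

definition K_functor :: "(('e, 'v) hypergraph, ('e \<Rightarrow> 'e) \<times> ('v \<Rightarrow> 'v),
    ('e, 'v) cell_tuple set sym_sset,
    nat \<Rightarrow> ('e, 'v) cell_tuple set \<Rightarrow> ('e, 'v) cell_tuple set) functor_data" where
  "K_functor = \<lparr>FObj = (\<lambda>H\<in>Obj Hyp. K_obj H),
     FMor = (\<lambda>H H' \<eta>. if H \<in> Obj Hyp \<and> H' \<in> Obj Hyp \<and> \<eta> \<in> Hom Hyp H H'
       then K_mor H H' \<eta> else undefined)\<rparr>"

end

theory Submission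
  imports Defs
begin

text \<open>
  The point is that the generating relation is already an equivalence relation. A tuple \<open>t\<close> that
  lies in the simplex of \<open>x\<close> and in the simplex of \<open>x'\<close> has all its entries in both vertex sets, so
  the two copies are identified in one step: \<open>(x, t)\<close> and \<open>(x', t')\<close> are equivalent iff \<open>t = t'\<close>
  (\<open>K_rel_eq\<close>). Hence \<open>\<K>(H)\<^sub>n\<close> is, up to renaming, the set of \<open>(n+1)\<close>-tuples of vertices whose
  entries lie in a common cell, and a class determines its tuple but not its cell
  (\<open>K_class_cong\<close>).

  Both formulas on representatives act on the tuple alone: a structure map composes it with
  \<open>\<mu>\<close> on the right, a hypergraph morphism with \<open>a\<close> on the left. They are therefore well defined as
  soon as the new tuple lies in the new cell (\<open>K_obj_FMor_class\<close>, \<open>K_mor_class\<close>). For a morphism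
  this last condition holds because \<open>(b, a)\<close> maps the vertex set of each cell onto the vertex set
  of its image (\<open>ext_ends_map_sum\<close>). Functoriality in \<open>\<mu>\<close> and in \<open>(b, a)\<close> is associativity of
  composition of maps, and naturality of \<open>\<K>(b, a)\<close> says that the composition on the left
  commutes with the composition on the right.
\<close>

section \<open>The ambient categories\<close>

lemma category_op_cat:
  assumes "category C"
  shows "category (op_cat C)"
proof -
  interpret category C by fact
  show ?thesis
    by unfold_locales
      (simp_all add: op_cat_def Ident_in Comp_in Comp_Ident_left Comp_Ident_right Comp_assoc)
qed

lemma compose_restrict_id:
  assumes "f \<in> A \<rightarrow>\<^sub>E B"
  shows "compose A (\<lambda>x\<in>B. x) f = f" and "compose A f (\<lambda>x\<in>A. x) = f"
  using assms by (auto simp: compose_def fun_eq_iff PiE_def extensional_def Pi_def)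

lemma compose_PiE:
  assumes "f \<in> A \<rightarrow>\<^sub>E B" and "g \<in> B \<rightarrow>\<^sub>E C"
  shows "compose A g f \<in> A \<rightarrow>\<^sub>E C"
  using assms by (auto simp: compose_def)

lemma compose_compose:
  assumes "f \<in> A \<rightarrow>\<^sub>E B"
  shows "compose A h (compose A g f) = compose A (compose B h g) f"
  using assms by (intro compose_assoc) (auto simp: PiE_def)

lemma category_FinSet: "category FinSet"
  by unfold_locales
    (simp_all add: FinSet_def compose_PiE compose_restrict_id compose_compose restrict_PiE_iff)

lemma category_sym_Delta: "category sym_Delta"
  by unfold_locales
    (simp_all add: sym_Delta_def compose_PiE compose_restrict_id compose_compose restrict_PiE_iff)

lemma category_Hyp: "category (Hyp :: (('e, 'v) hypergraph, _) cat)"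
proof
  fix H :: "('e, 'v) hypergraph"
  assume "H \<in> Obj Hyp"
  then have "hypergraph H"
    by (simp add: Hyp_def)
  then show "Ident Hyp H \<in> Hom Hyp H H"
    by (force simp: Hyp_def hyp_mor_def hypergraph_def nonempty_Pow_def)
next
  fix H H' H'' :: "('e, 'v) hypergraph" and f g
  assume obj: "H \<in> Obj Hyp" and f: "f \<in> Hom Hyp H H'" and g: "g \<in> Hom Hyp H' H''"
  obtain b a b' a' where eq: "f = (b, a)" "g = (b', a')"
    by fastforce
  have sub: "ends H e \<subseteq> verts H" if "e \<in> edges H" for e
    using obj that by (auto simp: Hyp_def hypergraph_def nonempty_Pow_def)
  have "ends H'' (compose (edges H) b' b e) = compose (verts H) a' a ` ends H e"
    if e: "e \<in> edges H" for e
  proof -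
    have "compose (verts H) a' a ` ends H e = a' ` a ` ends H e"
      using sub[OF e] by (force simp: compose_def)
    moreover have "b e \<in> edges H'"
      using f e by (auto simp: eq Hyp_def hyp_mor_def)
    ultimately show ?thesis
      using f g e by (simp add: eq Hyp_def hyp_mor_def compose_eq)
  qed
  then show "Comp Hyp H H' H'' g f \<in> Hom Hyp H H''"
    using f g compose_PiE[of b "edges H" "edges H'" b' "edges H''"]
      compose_PiE[of a "verts H" "verts H'" a' "verts H''"]
    by (simp add: eq Hyp_def hyp_mor_def)
next
  fix H H' :: "('e, 'v) hypergraph" and f
  assume "f \<in> Hom Hyp H H'"
  then show "Comp Hyp H H' H' (Ident Hyp H') f = f" "Comp Hyp H H H' f (Ident Hyp H) = f"
    by (auto simp: Hyp_def hyp_mor_def compose_restrict_id)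
next
  fix H1 H2 H3 H4 :: "('e, 'v) hypergraph" and f g h
  assume "f \<in> Hom Hyp H1 H2" "g \<in> Hom Hyp H2 H3" "h \<in> Hom Hyp H3 H4"
  then show "Comp Hyp H1 H3 H4 h (Comp Hyp H1 H2 H3 g f)
      = Comp Hyp H1 H2 H4 (Comp Hyp H2 H3 H4 h g) f"
    by (auto simp: Hyp_def hyp_mor_def compose_compose)
qed

lemma nat_transD:
  assumes "\<alpha> \<in> nat_trans C D F G"
  shows "\<alpha> \<in> extensional (Obj C)"
    and "c \<in> Obj C \<Longrightarrow> \<alpha> c \<in> Hom D (FObj F c) (FObj G c)"
    and "\<lbrakk>a \<in> Obj C; b \<in> Obj C; f \<in> Hom C a b\<rbrakk> \<Longrightarrow>
      Comp D (FObj F a) (FObj F b) (FObj G b) (\<alpha> b) (FMor F a b f)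
      = Comp D (FObj F a) (FObj G a) (FObj G b) (FMor G a b f) (\<alpha> a)"
  using assms by (auto simp: nat_trans_def PiE_def)

text \<open>
  The only axiom with content is that natural transformations compose: the two naturality squares
  are pasted along the arrow of the middle functor. The other axioms hold in \<open>D\<close> at each object.
\<close>

lemma category_functor_cat:
  assumes "category C" and "category D"
  shows "category (functor_cat C D)"
proof -
  interpret C: category C by fact
  interpret D: category D by fact
  have FO: "FObj F c \<in> Obj D" if "cat_functor C D F" "c \<in> Obj C" for F c
    using that by (rule cat_functor.FObj_in)
  have FM: "FMor F a b f \<in> Hom D (FObj F a) (FObj F b)"
    if "cat_functor C D F" "a \<in> Obj C" "b \<in> Obj C" "f \<in> Hom C a b" for F a b f
    using that by (rule cat_functor.FMor_in)
  show ?thesis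
  proof
    fix F
    assume "F \<in> Obj (functor_cat C D)"
    then show "Ident (functor_cat C D) F \<in> Hom (functor_cat C D) F F"
      by (simp add: functor_cat_def nat_trans_def D.Ident_in D.Comp_Ident_left
          D.Comp_Ident_right FO FM restrict_PiE_iff)
  next
    fix F G H \<alpha> \<beta>
    assume F: "F \<in> Obj (functor_cat C D)" and G: "G \<in> Obj (functor_cat C D)"
      and H: "H \<in> Obj (functor_cat C D)"
      and \<alpha>: "\<alpha> \<in> Hom (functor_cat C D) F G" and \<beta>: "\<beta> \<in> Hom (functor_cat C D) G H"
    note functors = F[unfolded functor_cat_def, simplified] G[unfolded functor_cat_def, simplified]
      H[unfolded functor_cat_def, simplified]
    have \<alpha>': "\<alpha> \<in> nat_trans C D F G" and \<beta>': "\<beta> \<in> nat_trans C D G H"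
      using \<alpha> \<beta> by (simp_all add: functor_cat_def)
    note in_Hom = nat_transD(2)[OF \<alpha>'] nat_transD(2)[OF \<beta>']
    note obj_in = FO[OF functors(1)] FO[OF functors(2)] FO[OF functors(3)]
    have nat: "Comp D (FObj F a) (FObj F b) (FObj H b)
          (Comp D (FObj F b) (FObj G b) (FObj H b) (\<beta> b) (\<alpha> b)) (FMor F a b f)
        = Comp D (FObj F a) (FObj H a) (FObj H b) (FMor H a b f)
          (Comp D (FObj F a) (FObj G a) (FObj H a) (\<beta> a) (\<alpha> a))"
      if a: "a \<in> Obj C" and b: "b \<in> Obj C" and f: "f \<in> Hom C a b" for a b f
    proof -
      note mor_in = FM[OF functors(1) a b f] FM[OF functors(2) a b f] FM[OF functors(3) a b f]
      have "Comp D (FObj F a) (FObj F b) (FObj H b)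
          (Comp D (FObj F b) (FObj G b) (FObj H b) (\<beta> b) (\<alpha> b)) (FMor F a b f)
        = Comp D (FObj F a) (FObj G b) (FObj H b) (\<beta> b)
            (Comp D (FObj F a) (FObj F b) (FObj G b) (\<alpha> b) (FMor F a b f))"
        using a b by (intro D.Comp_assoc[symmetric] obj_in mor_in in_Hom)
      also have "\<dots> = Comp D (FObj F a) (FObj G b) (FObj H b) (\<beta> b)
            (Comp D (FObj F a) (FObj G a) (FObj G b) (FMor G a b f) (\<alpha> a))"
        by (simp add: nat_transD(3)[OF \<alpha>' a b f])
      also have "\<dots> = Comp D (FObj F a) (FObj G a) (FObj H b)
            (Comp D (FObj G a) (FObj G b) (FObj H b) (\<beta> b) (FMor G a b f)) (\<alpha> a)"
        using a b by (intro D.Comp_assoc obj_in mor_in in_Hom)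
      also have "\<dots> = Comp D (FObj F a) (FObj G a) (FObj H b)
            (Comp D (FObj G a) (FObj H a) (FObj H b) (FMor H a b f) (\<beta> a)) (\<alpha> a)"
        by (simp add: nat_transD(3)[OF \<beta>' a b f])
      also have "\<dots> = Comp D (FObj F a) (FObj H a) (FObj H b) (FMor H a b f)
            (Comp D (FObj F a) (FObj G a) (FObj H a) (\<beta> a) (\<alpha> a))"
        using a b by (intro D.Comp_assoc[symmetric] obj_in mor_in in_Hom)
      finally show ?thesis .
    qed
    have "Comp D (FObj F c) (FObj G c) (FObj H c) (\<beta> c) (\<alpha> c) \<in> Hom D (FObj F c) (FObj H c)"
      if "c \<in> Obj C" for c
      using that by (intro D.Comp_in[of _ "FObj G c"] obj_in in_Hom)
    then show "Comp (functor_cat C D) F G H \<beta> \<alpha> \<in> Hom (functor_cat C D) F H"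
      by (simp add: functor_cat_def nat_trans_def nat restrict_PiE_iff)
  next
    fix F G \<alpha>
    assume F: "F \<in> Obj (functor_cat C D)" and G: "G \<in> Obj (functor_cat C D)"
      and \<alpha>: "\<alpha> \<in> Hom (functor_cat C D) F G"
    have \<alpha>': "\<alpha> \<in> nat_trans C D F G"
      using \<alpha> by (simp add: functor_cat_def)
    show "Comp (functor_cat C D) F G G (Ident (functor_cat C D) G) \<alpha> = \<alpha>"
      using F G nat_transD(2)[OF \<alpha>']
      by (intro extensionalityI[OF _ nat_transD(1)[OF \<alpha>']])
        (simp_all add: functor_cat_def D.Comp_Ident_left FO)
    show "Comp (functor_cat C D) F F G \<alpha> (Ident (functor_cat C D) F) = \<alpha>"
      using F G nat_transD(2)[OF \<alpha>']
      by (intro extensionalityI[OF _ nat_transD(1)[OF \<alpha>']])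
        (simp_all add: functor_cat_def D.Comp_Ident_right FO)
  next
    fix F1 F2 F3 F4 \<alpha> \<beta> \<gamma>
    assume obj: "F1 \<in> Obj (functor_cat C D)" "F2 \<in> Obj (functor_cat C D)"
        "F3 \<in> Obj (functor_cat C D)" "F4 \<in> Obj (functor_cat C D)"
      and hom: "\<alpha> \<in> Hom (functor_cat C D) F1 F2" "\<beta> \<in> Hom (functor_cat C D) F2 F3"
        "\<gamma> \<in> Hom (functor_cat C D) F3 F4"
    have "\<alpha> \<in> nat_trans C D F1 F2" "\<beta> \<in> nat_trans C D F2 F3" "\<gamma> \<in> nat_trans C D F3 F4"
      using hom by (simp_all add: functor_cat_def)
    note in_Hom = this[THEN nat_transD(2)]
    show "Comp (functor_cat C D) F1 F3 F4 \<gamma> (Comp (functor_cat C D) F1 F2 F3 \<beta> \<alpha>)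
        = Comp (functor_cat C D) F1 F2 F4 (Comp (functor_cat C D) F2 F3 F4 \<gamma> \<beta>) \<alpha>"
      using obj by (auto simp: functor_cat_def FO in_Hom intro!: restrict_ext D.Comp_assoc)
  qed
qed

section \<open>The simplices of \<open>\<K>(H)\<close>\<close>

text \<open>
  Transitivity is the only axiom that could fail for the generating relation. It holds because
  related pairs carry the same tuple, and that tuple then lies in both outer simplices.
\<close>

lemma K_rel_eq:
  "K_rel H n = {((x, t), (x', t')). (x, t) \<in> K_coprod H n \<and> (x', t') \<in> K_coprod H n \<and> t = t'}"
    (is "_ = ?R")
proof
  have "equiv (K_coprod H n) ?R"
    by (rule equivI) (auto simp: refl_on_def sym_def trans_def)
  moreover have "K_gen H n \<subseteq> ?R"
    by (force simp: K_gen_def K_coprod_def std_simplex_def PiE_iff)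
  ultimately show "K_rel H n \<subseteq> ?R"
    by (auto simp: K_rel_def)
  have "?R \<subseteq> K_gen H n"
    by (auto simp: K_gen_def K_coprod_def std_simplex_def PiE_iff)
  then show "?R \<subseteq> K_rel H n"
    by (auto simp: K_rel_def)
qed

lemma K_class_eq:
  assumes "(x, t) \<in> K_coprod H n"
  shows "K_class H n x t = {(x', t'). (x', t') \<in> K_coprod H n \<and> t' = t}"
  using assms by (auto simp: K_class_def K_rel_eq)

lemma K_class_cong:
  assumes "(x, t) \<in> K_coprod H n" and "(x', t) \<in> K_coprod H n"
  shows "K_class H n x t = K_class H n x' t"
  using assms by (simp add: K_class_eq)

lemma K_class_in_K_set:
  assumes "(x, t) \<in> K_coprod H n"
  shows "K_class H n x t \<in> K_set H n"
  using assms unfolding K_class_def K_set_def by (rule quotientI)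

lemma K_setE:
  assumes "c \<in> K_set H n"
  obtains x t where "(x, t) \<in> K_coprod H n" and "c = K_class H n x t"
proof -
  from assms obtain p where "p \<in> K_coprod H n" "c = K_rel H n `` {p}"
    unfolding K_set_def by (rule quotientE)
  then show thesis
    using that by (cases p) (simp add: K_class_def)
qed

text \<open>
  The criterion for a formula on representatives to descend to classes: its value may depend on
  the tuple only.
\<close>

lemma the_elem_image_K_class:
  assumes "(x, t) \<in> K_coprod H n"
    and "\<And>x'. (x', t) \<in> K_coprod H n \<Longrightarrow> g (x', t) = g (x, t)"
  shows "the_elem (g ` K_class H n x t) = g (x, t)"
proof -
  have "(x, t) \<in> K_class H n x t"
    using assms(1) by (simp add: K_class_eq)
  moreover have "g p = g (x, t)" if "p \<in> K_class H n x t" for p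
    using that assms(2) by (auto simp only: K_class_eq[OF assms(1)])
  ultimately have "g ` K_class H n x t = {g (x, t)}"
    by blast
  then show ?thesis
    by simp
qed

lemma ext_ends_subset_verts:
  assumes "hypergraph H" and "x \<in> cells H"
  shows "ext_ends H x \<subseteq> verts H"
proof -
  have "ends H e \<subseteq> verts H" if "e \<in> edges H" for e
    using assms(1) that by (simp add: hypergraph_def nonempty_Pow_def PiE_iff)
  then show ?thesis
    using assms(2) by (force simp: cells_def ext_ends_def)
qed

lemma finite_K_set:
  assumes "hypergraph H"
  shows "finite (K_set H n)"
proof -
  have "finite (ext_ends H x)" if "x \<in> cells H" for x
  proof (rule finite_subset)
    show "ext_ends H x \<subseteq> verts H" "finite (verts H)"
      using assms that by (simp_all add: ext_ends_subset_verts hypergraph_def)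
  qed
  moreover have "finite (cells H)"
    using assms by (simp add: hypergraph_def cells_def)
  ultimately have "finite (K_coprod H n)"
    unfolding K_coprod_def std_simplex_def by (auto intro!: finite_SigmaI finite_PiE)
  then show ?thesis
    unfolding K_set_def by (rule finite_quotient) (auto simp: K_rel_eq)
qed

section \<open>\<open>\<K>(H)\<close> as a symmetric simplicial set\<close>

lemma K_coprod_reindex:
  assumes "(x, t) \<in> K_coprod H n" and "\<mu> \<in> {..m} \<rightarrow>\<^sub>E {..n}"
  shows "(x, \<lambda>i\<in>{..m}. t (\<mu> i)) \<in> K_coprod H m"
  using assms by (auto simp: K_coprod_def std_simplex_def PiE_iff)

lemma FObj_K_obj [simp]: "FObj (K_obj H) n = K_set H n"
  by (simp add: K_obj_def)

lemma K_obj_FMor_class: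
  assumes "(x, t) \<in> K_coprod H n" and "\<mu> \<in> {..m} \<rightarrow>\<^sub>E {..n}"
  shows "FMor (K_obj H) n m \<mu> (K_class H n x t) = K_class H m x (\<lambda>i\<in>{..m}. t (\<mu> i))"
proof -
  have "the_elem ((\<lambda>(x, t). K_class H m x (\<lambda>i\<in>{..m}. t (\<mu> i))) ` K_class H n x t)
      = K_class H m x (\<lambda>i\<in>{..m}. t (\<mu> i))"
    using assms by (subst the_elem_image_K_class) (auto intro!: K_class_cong K_coprod_reindex)
  then show ?thesis
    using assms by (simp add: K_obj_def K_class_in_K_set)
qed

lemma K_obj_FMor_PiE:
  assumes "\<mu> \<in> {..m} \<rightarrow>\<^sub>E {..n}"
  shows "FMor (K_obj H) n m \<mu> \<in> K_set H n \<rightarrow>\<^sub>E K_set H m"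
proof (rule PiE_I)
  fix c
  assume "c \<in> K_set H n"
  then obtain x t where "(x, t) \<in> K_coprod H n" "c = K_class H n x t"
    by (rule K_setE)
  then show "FMor (K_obj H) n m \<mu> c \<in> K_set H m"
    using assms by (simp add: K_obj_FMor_class K_class_in_K_set K_coprod_reindex)
next
  fix c
  assume "c \<notin> K_set H n"
  then show "FMor (K_obj H) n m \<mu> c = undefined"
    using assms by (simp add: K_obj_def)
qed

lemma restrict_simplex_id:
  assumes "(x, t) \<in> K_coprod H n"
  shows "restrict t {..n} = t"
  using assms by (intro extensional_restrict) (simp add: K_coprod_def std_simplex_def PiE_iff)

lemma cat_functor_K_obj:
  assumes "hypergraph H"
  shows "cat_functor (op_cat sym_Delta) FinSet (K_obj H)"
proof -
  interpret op: category "op_cat sym_Delta"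
    by (intro category_op_cat category_sym_Delta)
  interpret FinSet: category FinSet
    by (rule category_FinSet)
  have op_simps [simp]: "Obj (op_cat sym_Delta) = UNIV"
    "Hom (op_cat sym_Delta) n m = {..m} \<rightarrow>\<^sub>E {..n}"
    "Ident (op_cat sym_Delta) n = (\<lambda>i\<in>{..n}. i)"
    "Comp (op_cat sym_Delta) n m l \<nu> \<mu> = compose {..l} \<mu> \<nu>" for n m l \<mu> \<nu>
    by (simp_all add: op_cat_def sym_Delta_def)
  show ?thesis
  proof
    fix n :: nat
    show "FObj (K_obj H) n \<in> Obj FinSet"
      using assms by (simp add: FinSet_def finite_K_set)
  next
    fix n m :: nat and \<mu>
    assume "\<mu> \<in> Hom (op_cat sym_Delta) n m"
    then show "FMor (K_obj H) n m \<mu> \<in> Hom FinSet (FObj (K_obj H) n) (FObj (K_obj H) m)"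
      using K_obj_FMor_PiE by (simp add: FinSet_def)
  next
    fix n :: nat
    have id: "(\<lambda>i\<in>{..n}. i) \<in> {..n} \<rightarrow>\<^sub>E {..n}"
      by (simp add: restrict_PiE_iff)
    have "FMor (K_obj H) n n (\<lambda>i\<in>{..n}. i) = (\<lambda>c\<in>K_set H n. c)"
    proof (rule extensionalityI)
      show "FMor (K_obj H) n n (\<lambda>i\<in>{..n}. i) \<in> extensional (K_set H n)"
        using K_obj_FMor_PiE[OF id, of H] by (simp add: PiE_def)
      fix c
      assume c: "c \<in> K_set H n"
      then obtain x t where xt: "(x, t) \<in> K_coprod H n" "c = K_class H n x t"
        by (rule K_setE)
      have "(\<lambda>i\<in>{..n}. t ((\<lambda>i\<in>{..n}. i) i)) = t"
        using restrict_simplex_id[OF xt(1)] by (simp cong: restrict_cong)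
      then show "FMor (K_obj H) n n (\<lambda>i\<in>{..n}. i) c = (\<lambda>c\<in>K_set H n. c) c"
        using c xt K_obj_FMor_class[OF xt(1) id] by simp
    qed simp
    then show "FMor (K_obj H) n n (Ident (op_cat sym_Delta) n) = Ident FinSet (FObj (K_obj H) n)"
      by (simp add: FinSet_def)
  next
    fix n m l :: nat and \<mu> \<nu>
    assume "\<mu> \<in> Hom (op_cat sym_Delta) n m" "\<nu> \<in> Hom (op_cat sym_Delta) m l"
    then have \<mu>: "\<mu> \<in> {..m} \<rightarrow>\<^sub>E {..n}" and \<nu>: "\<nu> \<in> {..l} \<rightarrow>\<^sub>E {..m}"
      by simp_all
    note \<mu>\<nu> = compose_PiE[OF \<nu> \<mu>]
    have "FMor (K_obj H) n l (compose {..l} \<mu> \<nu>)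
        = compose (K_set H n) (FMor (K_obj H) m l \<nu>) (FMor (K_obj H) n m \<mu>)"
    proof (rule extensionalityI)
      show "FMor (K_obj H) n l (compose {..l} \<mu> \<nu>) \<in> extensional (K_set H n)"
        using K_obj_FMor_PiE[OF \<mu>\<nu>, of H] by (simp add: PiE_def)
      fix c
      assume c: "c \<in> K_set H n"
      then obtain x t where xt: "(x, t) \<in> K_coprod H n" "c = K_class H n x t"
        by (rule K_setE)
      have "(\<lambda>i\<in>{..l}. t (compose {..l} \<mu> \<nu> i)) = (\<lambda>i\<in>{..l}. (\<lambda>j\<in>{..m}. t (\<mu> j)) (\<nu> i))"
        using \<nu> by (intro restrict_ext) (auto simp: compose_def PiE_iff)
      then show "FMor (K_obj H) n l (compose {..l} \<mu> \<nu>) c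
          = compose (K_set H n) (FMor (K_obj H) m l \<nu>) (FMor (K_obj H) n m \<mu>) c"
        using c xt \<mu> \<nu> \<mu>\<nu> by (simp add: compose_eq K_obj_FMor_class K_coprod_reindex)
    qed simp
    then show "FMor (K_obj H) n l (Comp (op_cat sym_Delta) n m l \<nu> \<mu>)
        = Comp FinSet (FObj (K_obj H) n) (FObj (K_obj H) m) (FObj (K_obj H) l)
            (FMor (K_obj H) m l \<nu>) (FMor (K_obj H) n m \<mu>)"
      by (simp add: FinSet_def)
  next
    fix n m :: nat and \<mu>
    assume "\<not> (n \<in> Obj (op_cat sym_Delta) \<and> m \<in> Obj (op_cat sym_Delta)
      \<and> \<mu> \<in> Hom (op_cat sym_Delta) n m)"
    then show "FMor (K_obj H) n m \<mu> = undefined"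
      by (simp add: K_obj_def)
  qed simp
qed

section \<open>The map induced by a hypergraph morphism\<close>

text \<open>
  On edges this is the commuting square in the definition of a morphism, on vertices it is
  trivial. It makes the image of a tuple in a cell a tuple in the image of that cell.
\<close>

lemma ext_ends_map_sum:
  assumes "(b, a) \<in> hyp_mor H H'" and "x \<in> cells H"
  shows "ext_ends H' (map_sum b a x) = a ` ext_ends H x"
  using assms by (auto simp: hyp_mor_def cells_def ext_ends_def)

lemma K_coprod_map:
  assumes "(b, a) \<in> hyp_mor H H'" and "(x, t) \<in> K_coprod H n"
  shows "(map_sum b a x, \<lambda>i\<in>{..n}. a (t i)) \<in> K_coprod H' n"
proof -
  have "x \<in> cells H"
    using assms(2) by (simp add: K_coprod_def)
  moreover from this have "map_sum b a x \<in> cells H'"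
    using assms(1) by (auto simp: hyp_mor_def cells_def)
  ultimately show ?thesis
    using assms by (auto simp: K_coprod_def std_simplex_def ext_ends_map_sum PiE_iff)
qed

lemma K_mor_class:
  assumes "(b, a) \<in> hyp_mor H H'" and "(x, t) \<in> K_coprod H n"
  shows "K_mor H H' (b, a) n (K_class H n x t)
    = K_class H' n (map_sum b a x) (\<lambda>i\<in>{..n}. a (t i))"
proof -
  have "the_elem ((\<lambda>(x, t). K_class H' n (map_sum b a x) (\<lambda>i\<in>{..n}. a (t i))) ` K_class H n x t)
      = K_class H' n (map_sum b a x) (\<lambda>i\<in>{..n}. a (t i))"
    using assms by (subst the_elem_image_K_class) (auto intro!: K_class_cong K_coprod_map)
  then show ?thesis
    using assms by (simp add: K_mor_def K_class_in_K_set)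
qed

lemma K_mor_extensional: "K_mor H H' \<eta> n \<in> extensional (K_set H n)"
  by (cases \<eta>) (simp add: K_mor_def)

lemma K_mor_PiE:
  assumes "\<eta> \<in> hyp_mor H H'"
  shows "K_mor H H' \<eta> n \<in> K_set H n \<rightarrow>\<^sub>E K_set H' n"
proof -
  obtain b a where \<eta>: "\<eta> = (b, a)"
    by (rule prod.exhaust)
  have "K_mor H H' \<eta> n c \<in> K_set H' n" if c: "c \<in> K_set H n" for c
  proof -
    obtain x t where "(x, t) \<in> K_coprod H n" "c = K_class H n x t"
      using c by (rule K_setE)
    then show ?thesis
      using assms by (simp add: \<eta> K_mor_class K_class_in_K_set K_coprod_map)
  qed
  then show ?thesis
    using K_mor_extensional[of H H' \<eta> n] by (simp add: PiE_def)
qed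

text \<open>
  Both sides of the naturality square send the class of \<open>t\<close> in \<open>x\<close> to the class of
  \<open>a \<circ> t \<circ> \<mu>\<close> in the image of \<open>x\<close>.
\<close>

lemma K_mor_nat_trans:
  assumes "\<eta> \<in> hyp_mor H H'"
  shows "K_mor H H' \<eta> \<in> nat_trans (op_cat sym_Delta) FinSet (K_obj H) (K_obj H')"
proof -
  obtain b a where \<eta>: "\<eta> = (b, a)"
    by (rule prod.exhaust)
  have "compose (K_set H n) (K_mor H H' \<eta> m) (FMor (K_obj H) n m \<mu>)
      = compose (K_set H n) (FMor (K_obj H') n m \<mu>) (K_mor H H' \<eta> n)"
    if \<mu>: "\<mu> \<in> {..m} \<rightarrow>\<^sub>E {..n}" for n m \<mu>
  proof (rule extensionalityI)
    fix c
    assume c: "c \<in> K_set H n"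
    then obtain x t where xt: "(x, t) \<in> K_coprod H n" "c = K_class H n x t"
      by (rule K_setE)
    have "(\<lambda>i\<in>{..m}. a ((\<lambda>i\<in>{..m}. t (\<mu> i)) i)) = (\<lambda>i\<in>{..m}. (\<lambda>j\<in>{..n}. a (t j)) (\<mu> i))"
      using \<mu> by (intro restrict_ext) (auto simp: PiE_iff)
    then show "compose (K_set H n) (K_mor H H' \<eta> m) (FMor (K_obj H) n m \<mu>) c
        = compose (K_set H n) (FMor (K_obj H') n m \<mu>) (K_mor H H' \<eta> n) c"
      using c xt \<mu> assms unfolding \<eta>
      by (simp add: compose_eq K_obj_FMor_class K_mor_class K_coprod_reindex K_coprod_map)
  qed simp_all
  then show ?thesis
    using K_mor_PiE[OF assms]
    by (simp add: nat_trans_def op_cat_def sym_Delta_def FinSet_def PiE_iff extensional_def)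
qed

lemma K_mor_Ident:
  assumes H: "hypergraph H"
  shows "K_mor H H (Ident Hyp H) n = (\<lambda>c\<in>K_set H n. c)"
proof (rule extensionalityI)
  fix c
  assume c: "c \<in> K_set H n"
  then obtain x t where xt: "(x, t) \<in> K_coprod H n" "c = K_class H n x t"
    by (rule K_setE)
  have mor: "(\<lambda>e\<in>edges H. e, \<lambda>v\<in>verts H. v) \<in> hyp_mor H H"
    using category.Ident_in[OF category_Hyp, of H] H by (simp add: Hyp_def)
  have x: "x \<in> cells H" and t: "t \<in> {..n} \<rightarrow>\<^sub>E ext_ends H x"
    using xt by (simp_all add: K_coprod_def std_simplex_def)
  \<comment> \<open>The identity arrow is the identity map on vertices only, so the entries of \<open>t\<close> must be vertices.\<close>
  have "ext_ends H x \<subseteq> verts H"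
    using H x by (rule ext_ends_subset_verts)
  then have "(\<lambda>i\<in>{..n}. (\<lambda>v\<in>verts H. v) (t i)) = restrict t {..n}"
    using t by (intro restrict_ext) (auto simp: PiE_iff)
  moreover have "map_sum (\<lambda>e\<in>edges H. e) (\<lambda>v\<in>verts H. v) x = x"
    using x by (auto simp: cells_def)
  ultimately show "K_mor H H (Ident Hyp H) n c = (\<lambda>c\<in>K_set H n. c) c"
    using c xt K_mor_class[OF mor xt(1)] by (simp add: Hyp_def restrict_simplex_id)
qed (simp_all add: K_mor_extensional)

lemma K_mor_Comp:
  assumes "hypergraph H" and "\<eta> \<in> hyp_mor H H'" and "\<theta> \<in> hyp_mor H' H''"
    and "Comp Hyp H H' H'' \<theta> \<eta> \<in> hyp_mor H H''"
  shows "K_mor H H'' (Comp Hyp H H' H'' \<theta> \<eta>) n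
    = compose (K_set H n) (K_mor H' H'' \<theta> n) (K_mor H H' \<eta> n)"
proof (rule extensionalityI)
  obtain b a b' a' where eq: "\<eta> = (b, a)" "\<theta> = (b', a')"
    by fastforce
  have comp: "Comp Hyp H H' H'' \<theta> \<eta> = (compose (edges H) b' b, compose (verts H) a' a)"
    by (simp add: eq Hyp_def)
  fix c
  assume c: "c \<in> K_set H n"
  then obtain x t where xt: "(x, t) \<in> K_coprod H n" "c = K_class H n x t"
    by (rule K_setE)
  have x: "x \<in> cells H" and t: "t \<in> {..n} \<rightarrow>\<^sub>E ext_ends H x"
    using xt by (simp_all add: K_coprod_def std_simplex_def)
  \<comment> \<open>The composite arrow agrees with \<open>a' \<circ> a\<close> on vertices only.\<close>
  have "ext_ends H x \<subseteq> verts H"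
    using assms(1) x by (rule ext_ends_subset_verts)
  then have tuple: "(\<lambda>i\<in>{..n}. compose (verts H) a' a (t i))
      = (\<lambda>i\<in>{..n}. a' ((\<lambda>i\<in>{..n}. a (t i)) i))"
    using t by (intro restrict_ext) (auto simp: compose_def PiE_iff)
  have cell: "map_sum (compose (edges H) b' b) (compose (verts H) a' a) x
      = map_sum b' a' (map_sum b a x)"
    using x by (auto simp: cells_def compose_def)
  have "K_mor H H'' (Comp Hyp H H' H'' \<theta> \<eta>) n c = K_class H'' n
      (map_sum b' a' (map_sum b a x)) (\<lambda>i\<in>{..n}. a' ((\<lambda>i\<in>{..n}. a (t i)) i))"
    using K_mor_class[OF assms(4)[unfolded comp] xt(1)] by (simp only: comp xt(2) tuple cell)
  also have "\<dots> = K_mor H' H'' \<theta> n (K_mor H H' \<eta> n c)"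
    using assms(2,3) xt unfolding eq by (simp add: K_mor_class K_coprod_map)
  finally show "K_mor H H'' (Comp Hyp H H' H'' \<theta> \<eta>) n c
      = compose (K_set H n) (K_mor H' H'' \<theta> n) (K_mor H H' \<eta> n) c"
    using c by (simp add: compose_eq)
qed (simp_all add: K_mor_extensional)

section \<open>The functor \<open>\<K>\<close>\<close>

lemma cat_functor_K_functor:
  "cat_functor Hyp (functor_cat (op_cat sym_Delta) FinSet)
    (K_functor :: (('e, 'v) hypergraph, _, _, _) functor_data)"
proof -
  interpret Hyp: category "Hyp :: (('e, 'v) hypergraph, _) cat"
    by (rule category_Hyp)
  interpret SSet: category "functor_cat (op_cat sym_Delta) FinSet"
    by (intro category_functor_cat category_op_cat category_sym_Delta category_FinSet)
  have Obj_Hyp: "H \<in> Obj Hyp \<longleftrightarrow> hypergraph H" for H :: "('e, 'v) hypergraph"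
    by (simp add: Hyp_def)
  have Hom_Hyp: "Hom Hyp = (hyp_mor :: ('e, 'v) hypergraph \<Rightarrow> _)"
    by (simp add: Hyp_def)
  show ?thesis
  proof
    fix H :: "('e, 'v) hypergraph"
    assume "H \<in> Obj Hyp"
    then show "FObj K_functor H \<in> Obj (functor_cat (op_cat sym_Delta) FinSet)"
      by (simp add: K_functor_def functor_cat_def Obj_Hyp cat_functor_K_obj)
  next
    fix H H' :: "('e, 'v) hypergraph" and \<eta>
    assume "H \<in> Obj Hyp" "H' \<in> Obj Hyp" "\<eta> \<in> Hom Hyp H H'"
    then show "FMor K_functor H H' \<eta>
        \<in> Hom (functor_cat (op_cat sym_Delta) FinSet) (FObj K_functor H) (FObj K_functor H')"
      by (simp add: K_functor_def functor_cat_def Hom_Hyp K_mor_nat_trans)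
  next
    fix H :: "('e, 'v) hypergraph"
    assume "H \<in> Obj Hyp"
    then show "FMor K_functor H H (Ident Hyp H)
        = Ident (functor_cat (op_cat sym_Delta) FinSet) (FObj K_functor H)"
      by (auto simp: K_functor_def functor_cat_def Obj_Hyp Hyp.Ident_in K_mor_Ident
          op_cat_def sym_Delta_def FinSet_def)
  next
    fix H H' H'' :: "('e, 'v) hypergraph" and \<eta> \<theta>
    assume asm: "H \<in> Obj Hyp" "H' \<in> Obj Hyp" "H'' \<in> Obj Hyp"
      "\<eta> \<in> Hom Hyp H H'" "\<theta> \<in> Hom Hyp H' H''"
    have comp: "Comp Hyp H H' H'' \<theta> \<eta> \<in> Hom Hyp H H''"
      using asm by (rule Hyp.Comp_in)
    have "K_mor H H'' (Comp Hyp H H' H'' \<theta> \<eta>) n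
        = compose (K_set H n) (K_mor H' H'' \<theta> n) (K_mor H H' \<eta> n)" for n
      using asm comp by (intro K_mor_Comp) (simp_all add: Obj_Hyp Hom_Hyp)
    then show "FMor K_functor H H'' (Comp Hyp H H' H'' \<theta> \<eta>)
        = Comp (functor_cat (op_cat sym_Delta) FinSet) (FObj K_functor H) (FObj K_functor H')
            (FObj K_functor H'') (FMor K_functor H' H'' \<theta>) (FMor K_functor H H' \<eta>)"
      using asm comp
      by (auto simp: K_functor_def functor_cat_def op_cat_def sym_Delta_def FinSet_def)
  qed (auto simp: K_functor_def)
qed

theorem theorem4p3:
  shows
    "(\<forall>H :: ('e, 'v) hypergraph. hypergraph H \<longrightarrow>
        fin_sym_sset (K_obj H) \<and>
        (\<forall>m n. \<forall>\<mu>\<in>Hom sym_Delta m n. \<forall>x\<in>cells H. \<forall>t\<in>FObj (std_simplex (ext_ends H x)) n.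
           FMor (K_obj H) n m \<mu> (K_class H n x t) = K_class H m x (\<lambda>i\<in>{..m}. t (\<mu> i)))) \<and>
     cat_functor Hyp (functor_cat (op_cat sym_Delta) FinSet)
       (K_functor :: (('e, 'v) hypergraph, _, _, _) functor_data) \<and>
     (\<forall>H :: ('e, 'v) hypergraph. hypergraph H \<longrightarrow> FObj K_functor H = K_obj H) \<and>
     (\<forall>(H :: ('e, 'v) hypergraph) H' b a. hypergraph H \<longrightarrow> hypergraph H' \<longrightarrow>
        (b, a) \<in> Hom Hyp H H' \<longrightarrow>
        (\<forall>n. \<forall>x\<in>cells H. \<forall>t\<in>FObj (std_simplex (ext_ends H x)) n.
           FMor K_functor H H' (b, a) n (K_class H n x t) =
             (case x of
                Inl e \<Rightarrow> K_class H' n (Inl (b e)) (\<lambda>i\<in>{..n}. a (t i))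
              | Inr v \<Rightarrow> K_class H' n (Inr (a v)) (\<lambda>i\<in>{..n}. a (t i)))))"
proof (intro conjI allI impI ballI)
  fix H :: "('e, 'v) hypergraph"
  assume H: "hypergraph H"
  show "fin_sym_sset (K_obj H)"
    using H by (simp add: fin_sym_sset_def cat_functor_K_obj)
  show "FObj K_functor H = K_obj H"
    using H by (simp add: K_functor_def Hyp_def)
  fix m n \<mu> x t
  assume "\<mu> \<in> Hom sym_Delta m n" "x \<in> cells H" "t \<in> FObj (std_simplex (ext_ends H x)) n"
  then show "FMor (K_obj H) n m \<mu> (K_class H n x t) = K_class H m x (\<lambda>i\<in>{..m}. t (\<mu> i))"
    by (intro K_obj_FMor_class) (simp_all add: K_coprod_def sym_Delta_def)
next
  show "cat_functor Hyp (functor_cat (op_cat sym_Delta) FinSet)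
      (K_functor :: (('e, 'v) hypergraph, _, _, _) functor_data)"
    by (rule cat_functor_K_functor)
next
  fix H H' :: "('e, 'v) hypergraph" and b a n x t
  assume asm: "hypergraph H" "hypergraph H'" "(b, a) \<in> Hom Hyp H H'" "x \<in> cells H"
    "t \<in> FObj (std_simplex (ext_ends H x)) n"
  then have "K_mor H H' (b, a) n (K_class H n x t)
      = K_class H' n (map_sum b a x) (\<lambda>i\<in>{..n}. a (t i))"
    by (intro K_mor_class) (simp_all add: Hyp_def K_coprod_def)
  then show "FMor K_functor H H' (b, a) n (K_class H n x t) =
      (case x of
         Inl e \<Rightarrow> K_class H' n (Inl (b e)) (\<lambda>i\<in>{..n}. a (t i))
       | Inr v \<Rightarrow> K_class H' n (Inr (a v)) (\<lambda>i\<in>{..n}. a (t i)))"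
    using asm by (auto simp: K_functor_def Hyp_def split: sum.split)
qed

end
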